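(* Let $d$ and $s$ be constants, let $A\subseteq\mathbb{R}^d$ be a Delone set with constants $0<r<R<\infty$, let $\sigma=\{0,1,\ldots,s\}$, let $\chi\colon A\to\sigma$ be a random coloring, and let $\Omega$ be the closed ball of radius $\omega>R$ centered at the origin. Writing $n=|A\cap\Omega|$ and $A_j=\chi^{-1}(j)$, the expected number of cells of the overlay $\mathrm{Ovl}\{\mathrm{Vor}(A_j): j\in\sigma\}$ that have at least one vertex in $\Omega$ is $O(n)$, with implied constant depending only on $d,s,r,R$.
   Context: $A$ is a Delone set with constants $0<r<R<\infty$ if every open ball of radius $r$ contains at most one point of $A$ and every closed ball of radius $R$ contains at least one point of $A$. A random coloring assigns colors from $\sigma$ to points independently and uniformly at random. $\mathrm{Vor}(A_j)$ is the Voronoi tessellation of the (locally finite) set $A_j$. The overlay is the decomposition of $\mathbb{R}^d$ whose $d$-cells are the intersections $\nu_0\cap\cdots\cap\nu_s$ with non-empty interior, $\nu_j$ a Voronoi domain of $A_j$, together with all their faces. *)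

theory Defs
  imports "HOL-Probability.Probability"
begin

definition delone :: "real \<Rightarrow> real \<Rightarrow> 'a::metric_space set \<Rightarrow> bool" where
  "delone r R A \<longleftrightarrow>
     (\<forall>x. \<forall>p\<in>A \<inter> ball x r. \<forall>q\<in>A \<inter> ball x r. p = q) \<and>
     (\<forall>x. A \<inter> cball x R \<noteq> {})"

definition voronoi_domain :: "'a::metric_space set \<Rightarrow> 'a \<Rightarrow> 'a set" where
  "voronoi_domain B a = {x. \<forall>b\<in>B. dist x a \<le> dist x b}"

text \<open>The tessellation is represented by its set of domains, which determine all lower-dimensional
  cells; in particular the empty set has the empty tessellation.\<close>

definition Vor :: "'a::metric_space set \<Rightarrow> 'a set set" where
  "Vor B = voronoi_domain B ` B"

definition overlay_top_cells :: "'j set \<Rightarrow> ('j \<Rightarrow> 'a::euclidean_space set set) \<Rightarrow> 'a set set" where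
  "overlay_top_cells J V =
     {c. \<exists>\<nu>. (\<forall>j\<in>J. \<nu> j \<in> V j) \<and> c = (\<Inter>j\<in>J. \<nu> j) \<and> interior c \<noteq> {}}"

text \<open>The library's \<open>face_of\<close> admits the empty face, which is not a cell, and the improper
  face, which is one.\<close>

definition Ovl :: "'j set \<Rightarrow> ('j \<Rightarrow> 'a::euclidean_space set set) \<Rightarrow> 'a set set" where
  "Ovl J V = {F. F \<noteq> {} \<and> (\<exists>c\<in>overlay_top_cells J V. F face_of c)}"

definition color_class :: "'a set \<Rightarrow> ('a \<Rightarrow> 'j) \<Rightarrow> 'j \<Rightarrow> 'a set" where
  "color_class A f j = {a \<in> A. f a = j}"

definition random_coloring :: "'a set \<Rightarrow> 'j set \<Rightarrow> ('a \<Rightarrow> 'j) measure" where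
  "random_coloring A \<sigma> = PiM A (\<lambda>_. uniform_count_measure \<sigma>)"

text \<open>Vertices of a cell are its 0-dimensional faces, i.e. its extreme points
  (\<open>face_of_singleton\<close>). Counting with \<open>count_space\<close> rather than \<open>card\<close>
  makes the number of elements of an infinite set \<open>\<infinity>\<close> instead of \<open>0\<close>.\<close>

definition num_cells_with_vertex_in :: "'a::euclidean_space set \<Rightarrow> 'a set set \<Rightarrow> ennreal" where
  "num_cells_with_vertex_in \<Omega> K =
     emeasure (count_space UNIV) {F \<in> K. \<exists>v\<in>\<Omega>. v extreme_point_of F}"

end

theory Submission
  imports Defs "HOL-Real_Asymp.Real_Asymp" "HOL-Computational_Algebra.Polynomial"
begin

text \<open>Let \<open>M y\<close> be the set of sites that are nearest to \<open>y\<close> within their color class. If every color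
  occurs, the cells of the overlay are exactly the sets \<open>{z. M y \<subseteq> M z}\<close>, and the vertices are the
  points \<open>v\<close> with \<open>{z. M v \<subseteq> M z} = {v}\<close>. A cell is determined by at most \<open>d + s + 1\<close> sites of
  \<open>M y\<close>: one of each color, and enough others for the normals of the bisectors to keep their span.
  If all colors occur within distance \<open>\<tau>\<close> of \<open>x\<close>, then \<open>M y \<subseteq> cball x (\<tau> + 4 * R)\<close> for every cell
  with a vertex in \<open>cball x (2 * R)\<close>, so the number of such cells is polynomial in \<open>\<tau>\<close>, while a
  color is missing from \<open>cball x \<tau>\<close> with probability exponentially small in \<open>\<tau>\<close>. Hence this number
  has bounded expectation, and \<open>\<Omega>\<close> is covered by the balls \<open>cball a (2 * R)\<close> with \<open>a \<in> A \<inter> \<Omega>\<close>.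
  The number is measurable because it depends on the colors of finitely many sites once all colors
  occur within distance \<open>\<tau>\<close>.\<close>

section \<open>Nearest sites\<close>

definition locally_finite :: "'a::metric_space set \<Rightarrow> bool" where
  "locally_finite A \<longleftrightarrow> (\<forall>x \<rho>. finite (A \<inter> cball x \<rho>))"

definition nearest_sites :: "'a::metric_space set \<Rightarrow> ('a \<Rightarrow> 'j) \<Rightarrow> 'a \<Rightarrow> 'a set" where
  "nearest_sites A f y = {a \<in> A. \<forall>b\<in>A. f b = f a \<longrightarrow> dist y a \<le> dist y b}"

lemma finite_subset_image_imp_Int_cball:
  fixes A :: "'a::metric_space set"
  assumes "finite J" "J \<subseteq> f ` A"
  shows "\<exists>\<tau>. J \<subseteq> f ` (A \<inter> cball x \<tau>)"
proof -
  obtain S where S: "S \<subseteq> A" "finite S" "J = f ` S"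
    using finite_subset_image[OF assms] by blast
  then obtain \<tau> where "\<forall>a\<in>S. dist x a \<le> \<tau>"
    using finite_imp_bounded bounded_any_center[of S x] by blast
  with S have "J \<subseteq> f ` (A \<inter> cball x \<tau>)" by auto
  then show ?thesis by blast
qed

lemma nearest_sites_subset: "nearest_sites A f y \<subseteq> A"
  by (auto simp: nearest_sites_def)

lemma nearest_sites_dist_le:
  "\<lbrakk>p \<in> nearest_sites A f y; b \<in> A; f b = f p\<rbrakk> \<Longrightarrow> dist y p \<le> dist y b"
  by (auto simp: nearest_sites_def)

lemma nearest_sites_dist_eq:
  "\<lbrakk>p \<in> nearest_sites A f y; q \<in> nearest_sites A f y; f p = f q\<rbrakk> \<Longrightarrow> dist y p = dist y q"
  by (auto simp: nearest_sites_def intro: antisym)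

lemma nearest_sites_if_dist_le:
  "\<lbrakk>p \<in> nearest_sites A f y; b \<in> A; f b = f p; dist y b \<le> dist y p\<rbrakk> \<Longrightarrow> b \<in> nearest_sites A f y"
  by (auto simp: nearest_sites_def intro: order_trans)

lemma nearest_sites_cong:
  "(\<And>a. a \<in> A \<Longrightarrow> f a = g a) \<Longrightarrow> nearest_sites A f y = nearest_sites A g y"
  by (auto simp: nearest_sites_def)

lemma image_nearest_sites:
  fixes A :: "'a::metric_space set"
  assumes "locally_finite A"
  shows "f ` nearest_sites A f y = f ` A"
proof (intro equalityI subsetI)
  fix j assume "j \<in> f ` A"
  then obtain a where a: "a \<in> A" "f a = j" by blast
  define B where "B = {b \<in> A \<inter> cball y (dist y a). f b = j}"
  have "finite (A \<inter> cball y (dist y a))" using assms by (simp add: locally_finite_def)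
  then have "finite B" unfolding B_def by (rule finite_subset[rotated]) auto
  moreover have "B \<noteq> {}" using a by (auto simp: B_def)
  ultimately obtain p where p: "p \<in> B" "\<And>b. b \<in> B \<Longrightarrow> dist y p \<le> dist y b"
    using ex_is_arg_min_if_finite[of B "dist y"] by (auto simp: is_arg_min_linorder)
  have "dist y p \<le> dist y b" if "b \<in> A" "f b = j" for b
    using p that by (cases "b \<in> B") (auto simp: B_def)
  then show "j \<in> f ` nearest_sites A f y"
    using p(1) by (auto simp: nearest_sites_def B_def)
qed (use nearest_sites_subset in fast)

lemma nearest_sites_Int_cball:
  assumes colors: "f ` A \<subseteq> f ` (A \<inter> cball x \<tau>)" and z: "dist x z \<le> \<rho>"
  shows "nearest_sites A f z = nearest_sites (A \<inter> cball x (\<tau> + 2 * \<rho>)) f z"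
proof -
  have near: "\<exists>q\<in>A \<inter> cball x (\<tau> + 2 * \<rho>). f q = f p \<and> dist z q \<le> \<tau> + \<rho>" if p: "p \<in> A" for p
  proof -
    obtain q where q: "q \<in> A" "f q = f p" "dist x q \<le> \<tau>"
      using colors p by fastforce
    have "dist z q \<le> dist x z + dist x q" by (rule dist_triangle3)
    moreover have "0 \<le> \<rho>" using z zero_le_dist order_trans by blast
    ultimately show ?thesis using q z by (intro bexI[of _ q]) auto
  qed
  have far: "\<tau> + \<rho> < dist z b" if "b \<notin> cball x (\<tau> + 2 * \<rho>)" for b
    using that z dist_triangle[of x b z] by simp
  show ?thesis
  proof (intro equalityI subsetI)
    fix p assume p: "p \<in> nearest_sites A f z"
    then have "p \<in> cball x (\<tau> + 2 * \<rho>)"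
      using near[of p] far[of p] nearest_sites_dist_le[OF p] nearest_sites_subset by fastforce
    with p show "p \<in> nearest_sites (A \<inter> cball x (\<tau> + 2 * \<rho>)) f z"
      by (auto simp: nearest_sites_def)
  next
    fix p assume p: "p \<in> nearest_sites (A \<inter> cball x (\<tau> + 2 * \<rho>)) f z"
    then have "p \<in> A" using nearest_sites_subset by blast
    have "dist z p \<le> dist z b" if "b \<in> A" "f b = f p" for b
      using near[OF \<open>p \<in> A\<close>] far[of b] nearest_sites_dist_le[OF p] that
      by (cases "b \<in> cball x (\<tau> + 2 * \<rho>)") fastforce+
    with \<open>p \<in> A\<close> show "p \<in> nearest_sites A f z"
      by (auto simp: nearest_sites_def)
  qed
qed

corollary nearest_sites_subset_cball:
  assumes "f ` A \<subseteq> f ` (A \<inter> cball x \<tau>)" "dist x z \<le> \<rho>"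
  shows "nearest_sites A f z \<subseteq> A \<inter> cball x (\<tau> + 2 * \<rho>)"
  unfolding nearest_sites_Int_cball[OF assms] by (rule nearest_sites_subset)

lemma finite_nearest_sites:
  assumes "locally_finite A" "finite (f ` A)"
  shows "finite (nearest_sites A f y)"
proof -
  obtain \<tau> where "f ` A \<subseteq> f ` (A \<inter> cball y \<tau>)"
    using finite_subset_image_imp_Int_cball[OF assms(2) order_refl] by blast
  then have "nearest_sites A f y \<subseteq> A \<inter> cball y (\<tau> + 2 * 0)"
    by (intro nearest_sites_subset_cball) auto
  with assms(1) show ?thesis
    unfolding locally_finite_def by (meson finite_subset)
qed

lemma eventually_nearest_sites_subset:
  fixes A :: "'a::metric_space set"
  assumes "locally_finite A" "finite (f ` A)"
  shows "\<forall>\<^sub>F z in nhds y. nearest_sites A f z \<subseteq> nearest_sites A f y"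
proof -
  obtain \<tau> where \<tau>: "f ` A \<subseteq> f ` (A \<inter> cball y \<tau>)"
    using finite_subset_image_imp_Int_cball[OF assms(2) order_refl] by blast
  define D where "D = A \<inter> cball y (\<tau> + 2 * 1) - nearest_sites A f y"
  have "\<forall>\<^sub>F z in nhds y. b \<notin> nearest_sites A f z" if b: "b \<in> D" for b
  proof -
    obtain p where p: "p \<in> A" "f p = f b" "dist y p < dist y b"
      using b by (force simp: D_def nearest_sites_def)
    have "open {z. dist z p < dist z b}"
      by (intro open_Collect_less continuous_intros)
    with p(3) have "\<forall>\<^sub>F z in nhds y. z \<in> {z. dist z p < dist z b}"
      by (intro eventually_nhds_in_open) auto
    then show ?thesis
      by eventually_elim (use p in \<open>auto simp: nearest_sites_def not_le\<close>)
  qed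
  moreover have "finite D" using assms(1) by (simp add: D_def locally_finite_def)
  ultimately have "\<forall>\<^sub>F z in nhds y. \<forall>b\<in>D. b \<notin> nearest_sites A f z"
    by (simp add: eventually_ball_finite)
  moreover have "\<forall>\<^sub>F z in nhds y. z \<in> ball y 1"
    by (intro eventually_nhds_in_open) auto
  ultimately show ?thesis
  proof eventually_elim
    case (elim z)
    then have "nearest_sites A f z \<subseteq> A \<inter> cball y (\<tau> + 2 * 1)"
      by (intro nearest_sites_subset_cball[OF \<tau>]) auto
    with elim show ?case by (auto simp: D_def)
  qed
qed

section \<open>Cells as sets of points with common nearest sites\<close>

lemma dist_le_iff_inner:
  fixes z p q :: "'a::real_inner"
  shows "dist z p \<le> dist z q \<longleftrightarrow> (q - p) \<bullet> z \<le> (q \<bullet> q - p \<bullet> p) / 2"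
  unfolding dist_norm norm_le by (simp add: inner_diff inner_commute field_simps)

lemma dist_eq_iff_inner:
  fixes z p q :: "'a::real_inner"
  shows "dist z p = dist z q \<longleftrightarrow> (q - p) \<bullet> z = (q \<bullet> q - p \<bullet> p) / 2"
  unfolding dist_norm norm_eq by (simp add: inner_diff inner_commute field_simps)

lemma dist_eq_iff_inner_diff:
  fixes y z p q :: "'a::real_inner"
  assumes "dist y p = dist y q"
  shows "dist z p = dist z q \<longleftrightarrow> (z - y) \<bullet> (p - q) = 0"
  using assms by (auto simp: dist_eq_iff_inner inner_diff inner_commute)

definition site_cell :: "'a::metric_space set \<Rightarrow> ('a \<Rightarrow> 'j) \<Rightarrow> 'a set \<Rightarrow> 'a set" where
  "site_cell A f S = {z. S \<subseteq> nearest_sites A f z}"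

abbreviation cell_around :: "'a::metric_space set \<Rightarrow> ('a \<Rightarrow> 'j) \<Rightarrow> 'a \<Rightarrow> 'a set" where
  "cell_around A f y \<equiv> site_cell A f (nearest_sites A f y)"

lemma inj_on_site_cell: "inj_on (site_cell A f) (range (nearest_sites A f))"
proof (rule inj_onI, clarify)
  fix y z assume "cell_around A f y = cell_around A f z"
  then have "y \<in> cell_around A f z" "z \<in> cell_around A f y"
    by (auto simp: site_cell_def)
  then show "nearest_sites A f y = nearest_sites A f z"
    by (auto simp: site_cell_def)
qed

lemma convex_site_cell:
  fixes A :: "'a::real_inner set"
  assumes "S \<subseteq> A"
  shows "convex (site_cell A f S)"
proof -
  have "site_cell A f S = (\<Inter>p\<in>S. \<Inter>b\<in>{b\<in>A. f b = f p}. {z. dist z p \<le> dist z b})"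
    using assms by (auto simp: site_cell_def nearest_sites_def)
  then show ?thesis
    by (simp only: dist_le_iff_inner) (intro convex_INT convex_halfspace_le)
qed

lemma mem_site_cell_iff_dist_eq:
  assumes "T \<subseteq> S" "S \<subseteq> A" and colors: "f ` S \<subseteq> f ` T"
  shows "z \<in> site_cell A f S \<longleftrightarrow>
    z \<in> site_cell A f T \<and> (\<forall>p\<in>S. \<forall>q\<in>T. f p = f q \<longrightarrow> dist z q = dist z p)"
proof (intro iffI conjI ballI impI)
  assume z: "z \<in> site_cell A f S"
  then show "z \<in> site_cell A f T" using assms(1) by (auto simp: site_cell_def)
  fix p q assume "p \<in> S" "q \<in> T" "f p = f q"
  then show "dist z q = dist z p"
    using z assms(1) by (intro nearest_sites_dist_eq[of q A f z p]) (auto simp: site_cell_def)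
next
  assume z: "z \<in> site_cell A f T \<and> (\<forall>p\<in>S. \<forall>q\<in>T. f p = f q \<longrightarrow> dist z q = dist z p)"
  have "p \<in> nearest_sites A f z" if p: "p \<in> S" for p
  proof -
    obtain q where "q \<in> T" "f p = f q" using colors p by fastforce
    then have "q \<in> nearest_sites A f z" "dist z q = dist z p" "f p = f q"
      using z p by (auto simp: site_cell_def)
    then show ?thesis
      using p assms(2) by (intro nearest_sites_if_dist_le[of q A f z p]) auto
  qed
  then show "z \<in> site_cell A f S" by (auto simp: site_cell_def)
qed

lemma site_cell_face_of:
  fixes A :: "'a::euclidean_space set"
  assumes "T \<subseteq> S" "S \<subseteq> A" "f ` S \<subseteq> f ` T"
  shows "site_cell A f S face_of site_cell A f T"
proof -
  define \<H> where "\<H> = {site_cell A f T \<inter> {z. dist z q = dist z p} | p q. p \<in> S \<and> q \<in> T \<and> f p = f q}"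
  have convex: "convex (site_cell A f T)"
    using assms by (intro convex_site_cell) auto
  have "site_cell A f T \<inter> {z. dist z q = dist z p} face_of site_cell A f T"
    if pq: "p \<in> S" "q \<in> T" "f p = f q" for p q
    unfolding dist_eq_iff_inner
  proof (rule face_of_Int_supporting_hyperplane_le[OF convex])
    fix z assume "z \<in> site_cell A f T"
    then have "dist z q \<le> dist z p"
      using pq assms(2) by (intro nearest_sites_dist_le[of q A f z]) (auto simp: site_cell_def)
    then show "(p - q) \<bullet> z \<le> (p \<bullet> p - q \<bullet> q) / 2"
      by (simp only: dist_le_iff_inner)
  qed
  then have "\<Inter>(insert (site_cell A f T) \<H>) face_of site_cell A f T"
    using face_of_refl[OF convex] by (intro face_of_Inter) (auto simp: \<H>_def)
  moreover have "site_cell A f S = \<Inter>(insert (site_cell A f T) \<H>)"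
    unfolding \<H>_def set_eq_iff mem_site_cell_iff_dist_eq[OF assms] by blast
  ultimately show ?thesis by simp
qed

lemma cell_around_face_of:
  fixes A :: "'a::euclidean_space set"
  assumes "locally_finite A" "T \<subseteq> nearest_sites A f z" "f ` A \<subseteq> f ` T"
  shows "cell_around A f z face_of site_cell A f T"
  using assms by (intro site_cell_face_of nearest_sites_subset) (simp_all add: image_nearest_sites)

lemma mem_rel_interior_cell_around:
  fixes A :: "'a::euclidean_space set"
  assumes "locally_finite A" "finite (f ` A)"
  shows "y \<in> rel_interior (cell_around A f y)"
proof -
  let ?M = "nearest_sites A f"
  define E where "E = (\<Inter>p\<in>?M y. \<Inter>q\<in>{q \<in> ?M y. f p = f q}. {z. dist z p = dist z q})"
  have "affine E"
    unfolding E_def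
    by (intro affine_Inter) (force simp only: dist_eq_iff_inner intro!: affine_hyperplane)
  moreover have "cell_around A f y \<subseteq> E"
    by (auto simp: E_def site_cell_def intro: nearest_sites_dist_eq)
  ultimately have hull: "affine hull (cell_around A f y) \<subseteq> E"
    by (intro hull_minimal)
  obtain U where U: "open U" "y \<in> U" "\<forall>z\<in>U. ?M z \<subseteq> ?M y"
    using eventually_nearest_sites_subset[OF assms, of y] unfolding eventually_nhds by blast
  have "z \<in> cell_around A f y" if z: "z \<in> U \<inter> E" for z
  proof -
    have "p \<in> ?M z" if p: "p \<in> ?M y" for p
    proof -
      have "f p \<in> f ` ?M z"
        using p nearest_sites_subset[of A f y] by (auto simp: image_nearest_sites[OF assms(1)])
      then obtain q where q: "q \<in> ?M z" "f p = f q" by blast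
      then have "dist z p = dist z q" using z p U(3) by (auto simp: E_def)
      then show ?thesis
        using q p nearest_sites_subset[of A f y] by (intro nearest_sites_if_dist_le[OF q(1)]) auto
    qed
    then show ?thesis by (auto simp: site_cell_def)
  qed
  with hull have "U \<inter> affine hull (cell_around A f y) \<subseteq> cell_around A f y" by blast
  moreover have "y \<in> cell_around A f y" by (simp add: site_cell_def)
  ultimately show ?thesis
    unfolding mem_rel_interior using U(1,2) by blast
qed

lemma face_of_site_cell_eq_cell_around:
  fixes A :: "'a::euclidean_space set"
  assumes fin: "locally_finite A" "finite (f ` A)" and T: "T \<subseteq> A" "f ` A \<subseteq> f ` T"
    and F: "F face_of site_cell A f T" and y: "y \<in> rel_interior F"
  shows "F = cell_around A f y"
proof (rule face_of_eq[OF F])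
  have "y \<in> site_cell A f T"
    using y rel_interior_subset F face_of_imp_subset by blast
  then have "T \<subseteq> nearest_sites A f y" by (simp add: site_cell_def)
  then show "cell_around A f y face_of site_cell A f T"
    using T(2) by (intro cell_around_face_of fin(1))
  show "rel_interior F \<inter> rel_interior (cell_around A f y) \<noteq> {}"
    using y mem_rel_interior_cell_around[OF fin] by blast
qed

lemma nearest_sites_open_segment:
  fixes A :: "'a::euclidean_space set"
  assumes locfin: "locally_finite A" and vy: "nearest_sites A f y \<subseteq> nearest_sites A f v"
    and z: "z \<in> open_segment v y"
  shows "nearest_sites A f z = nearest_sites A f y"
proof
  have v: "v \<in> cell_around A f y" and y: "y \<in> cell_around A f y"
    using vy by (auto simp: site_cell_def)
  have "convex (cell_around A f y)"
    by (intro convex_site_cell nearest_sites_subset)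
  then have "open_segment v y \<subseteq> cell_around A f y"
    using v y by (simp add: convex_contains_open_segment)
  with z show yz: "nearest_sites A f y \<subseteq> nearest_sites A f z"
    by (auto simp: site_cell_def)
  have "cell_around A f z face_of cell_around A f y"
    using locfin yz by (intro cell_around_face_of) (simp_all add: image_nearest_sites)
  moreover have "z \<in> cell_around A f z" by (simp add: site_cell_def)
  ultimately have "y \<in> cell_around A f z" using face_ofD z v y by blast
  then show "nearest_sites A f z \<subseteq> nearest_sites A f y"
    by (simp add: site_cell_def)
qed

definition overlay_vertex :: "'a::metric_space set \<Rightarrow> ('a \<Rightarrow> 'j) \<Rightarrow> 'a \<Rightarrow> bool" where
  "overlay_vertex A f v \<longleftrightarrow> cell_around A f v = {v}"

lemma extreme_point_of_cell_around_iff: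
  fixes A :: "'a::euclidean_space set"
  assumes fin: "locally_finite A" "finite (f ` A)"
  shows "v extreme_point_of cell_around A f y \<longleftrightarrow>
    nearest_sites A f y \<subseteq> nearest_sites A f v \<and> overlay_vertex A f v"
proof -
  have colors: "f ` A \<subseteq> f ` nearest_sites A f y" by (simp add: image_nearest_sites[OF fin(1)])
  show ?thesis
    unfolding overlay_vertex_def
  proof (intro iffI conjI)
    assume v: "v extreme_point_of cell_around A f y"
    then show "nearest_sites A f y \<subseteq> nearest_sites A f v"
      by (simp add: extreme_point_of_def site_cell_def)
    have "{v} face_of cell_around A f y" using v by (simp add: face_of_singleton)
    then show "cell_around A f v = {v}"
      using face_of_site_cell_eq_cell_around[OF fin nearest_sites_subset colors] by fastforce
  next
    assume v: "nearest_sites A f y \<subseteq> nearest_sites A f v \<and> cell_around A f v = {v}"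
    then have "cell_around A f v face_of cell_around A f y"
      using fin(1) colors by (intro cell_around_face_of) auto
    with v show "v extreme_point_of cell_around A f y" by (simp add: face_of_singleton)
  qed
qed

lemma convex_eq_singleton_iff_Int_open:
  fixes C :: "'a::real_normed_vector set"
  assumes "convex C" "open U" "v \<in> U"
  shows "C = {v} \<longleftrightarrow> C \<inter> U = {v}"
proof
  assume CU: "C \<inter> U = {v}"
  then have "openin (top_of_set C) {v}"
    using openin_open_Int[OF assms(2)] by metis
  moreover have "closedin (top_of_set C) {v}"
    using CU by (intro closed_subset) auto
  ultimately show "C = {v}"
    using convex_connected[OF assms(1)] unfolding connected_clopen by blast
qed (use assms in blast)

lemma overlay_vertex_cong:
  fixes A :: "'a::real_inner set" and f g :: "'a \<Rightarrow> 'j"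
  assumes "open U" "v \<in> U" and eq: "\<And>z. z \<in> U \<Longrightarrow> nearest_sites A f z = nearest_sites A g z"
  shows "overlay_vertex A f v \<longleftrightarrow> overlay_vertex A g v"
proof -
  have "cell_around A f v \<inter> U = cell_around A g v \<inter> U"
    using assms by (auto simp: site_cell_def)
  moreover have "overlay_vertex A h v \<longleftrightarrow> cell_around A h v \<inter> U = {v}" for h :: "'a \<Rightarrow> 'j"
    unfolding overlay_vertex_def using assms(1,2)
    by (intro convex_eq_singleton_iff_Int_open convex_site_cell nearest_sites_subset)
  ultimately show ?thesis by simp
qed

definition bisector_normals :: "('a::real_vector \<Rightarrow> 'j) \<Rightarrow> 'a set \<Rightarrow> 'a set" where
  "bisector_normals f S = {p - q | p q. p \<in> S \<and> q \<in> S \<and> f p = f q}"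

lemma ex_subset_card_le_DIM_span_image:
  fixes g :: "'b \<Rightarrow> 'a::euclidean_space"
  shows "\<exists>U\<subseteq>S. card U \<le> DIM('a) \<and> g ` S \<subseteq> span (g ` U)"
proof -
  obtain B where B: "B \<subseteq> g ` S" "independent B" "g ` S \<subseteq> span B"
    using maximal_independent_subset by blast
  obtain U where U: "U \<subseteq> S" "inj_on g U" "B = g ` U"
    using B(1) unfolding subset_image_inj by blast
  have "card U \<le> DIM('a)" using independent_bound[OF B(2)] U by (simp add: card_image)
  with U B(3) show ?thesis by blast
qed

lemma ex_small_subset_span_bisector_normals:
  fixes S :: "'a::euclidean_space set"
  shows "\<exists>U\<subseteq>S. f ` S \<subseteq> f ` U \<and> card U \<le> DIM('a) + card (f ` S) \<and>
    bisector_normals f S \<subseteq> span (bisector_normals f U)"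
proof -
  obtain T where T: "T \<subseteq> S" "inj_on f T" "f ` S = f ` T"
    using subset_image_inj[of "f ` S" f S] by auto
  define a where "a p = the_inv_into T f (f p)" for p
  have a: "a p \<in> T" "f (a p) = f p" if "p \<in> S" for p
  proof -
    have "f p \<in> f ` T" using that T(3) by blast
    then show "a p \<in> T" "f (a p) = f p"
      using T(2) by (simp_all add: a_def the_inv_into_into f_the_inv_into_f)
  qed
  obtain U where U: "U \<subseteq> S" "card U \<le> DIM('a)"
    and span: "(\<lambda>p. p - a p) ` S \<subseteq> span ((\<lambda>p. p - a p) ` U)"
    using ex_subset_card_le_DIM_span_image by meson
  have "card T = card (f ` S)" using T by (simp add: card_image)
  with U(2) have "card (U \<union> T) \<le> DIM('a) + card (f ` S)"
    using card_Un_le[of U T] by linarith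
  moreover have "bisector_normals f S \<subseteq> span (bisector_normals f (U \<union> T))"
  proof
    fix v assume "v \<in> bisector_normals f S"
    then obtain p q where v: "v = p - q" "p \<in> S" "q \<in> S" "f p = f q"
      by (auto simp: bisector_normals_def)
    have "(p - a p) - (q - a q) \<in> span ((\<lambda>p. p - a p) ` U)"
      using v span by (blast intro: span_diff)
    moreover have "(p - a p) - (q - a q) = v" using v by (simp add: a_def)
    moreover have "(\<lambda>p. p - a p) ` U \<subseteq> bisector_normals f (U \<union> T)"
      using a U(1) unfolding bisector_normals_def by fastforce
    then have "span ((\<lambda>p. p - a p) ` U) \<subseteq> span (bisector_normals f (U \<union> T))"
      by (rule span_mono)
    ultimately show "v \<in> span (bisector_normals f (U \<union> T))" by auto
  qed
  ultimately show ?thesis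
    using U(1) T by (intro exI[of _ "U \<union> T"]) auto
qed

lemma bisector_normal_orthogonal:
  fixes A :: "'a::real_inner set"
  assumes "U \<subseteq> nearest_sites A f y" "U \<subseteq> nearest_sites A f z" "v \<in> bisector_normals f U"
  shows "(z - y) \<bullet> v = 0"
proof -
  obtain p q where v: "v = p - q" and pq: "p \<in> U" "q \<in> U" "f p = f q"
    using assms(3) by (auto simp: bisector_normals_def)
  have "dist y p = dist y q" "dist z p = dist z q"
    using pq assms(1,2) by (blast intro: nearest_sites_dist_eq)+
  then show ?thesis using dist_eq_iff_inner_diff v by blast
qed

lemma site_cell_eq_cell_around_if_span:
  fixes A :: "'a::real_inner set"
  assumes U: "U \<subseteq> nearest_sites A f y" and colors: "f ` nearest_sites A f y \<subseteq> f ` U"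
    and span: "bisector_normals f (nearest_sites A f y) \<subseteq> span (bisector_normals f U)"
  shows "site_cell A f U = cell_around A f y"
proof (intro equalityI subsetI)
  fix z assume "z \<in> site_cell A f U"
  then have z: "U \<subseteq> nearest_sites A f z" by (simp add: site_cell_def)
  have "span (bisector_normals f U) \<subseteq> {v. (z - y) \<bullet> v = 0}"
    using bisector_normal_orthogonal[OF U z] by (intro span_minimal subspace_hyperplane) auto
  with span have orthogonal: "bisector_normals f (nearest_sites A f y) \<subseteq> {v. (z - y) \<bullet> v = 0}"
    by blast
  have "p \<in> nearest_sites A f z" if p: "p \<in> nearest_sites A f y" for p
  proof -
    obtain q where q: "q \<in> U" "f p = f q" using colors p by blast
    have "p - q \<in> bisector_normals f (nearest_sites A f y)"
      using p q U by (auto simp: bisector_normals_def)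
    moreover have "dist y p = dist y q"
      using p q U by (intro nearest_sites_dist_eq[of p A f y q]) auto
    ultimately have "dist z p = dist z q" using orthogonal dist_eq_iff_inner_diff by blast
    then show ?thesis
      using p q z nearest_sites_subset[of A f y]
      by (intro nearest_sites_if_dist_le[of q A f z p]) auto
  qed
  then show "z \<in> cell_around A f y" by (auto simp: site_cell_def)
qed (use U in \<open>auto simp: site_cell_def\<close>)

corollary ex_small_site_cell_eq_cell_around:
  fixes A :: "'a::euclidean_space set"
  assumes "locally_finite A"
  shows "\<exists>U\<subseteq>nearest_sites A f y. card U \<le> DIM('a) + card (f ` A) \<and>
    site_cell A f U = cell_around A f y"
proof -
  obtain U where U: "U \<subseteq> nearest_sites A f y" "f ` nearest_sites A f y \<subseteq> f ` U"
      "bisector_normals f (nearest_sites A f y) \<subseteq> span (bisector_normals f U)"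
    and "card U \<le> DIM('a) + card (f ` nearest_sites A f y)"
    using ex_small_subset_span_bisector_normals[of "nearest_sites A f y" f] by blast
  moreover have "site_cell A f U = cell_around A f y"
    using U by (rule site_cell_eq_cell_around_if_span)
  ultimately show ?thesis by (auto simp: image_nearest_sites[OF assms])
qed

section \<open>The cells of the overlay\<close>

abbreviation color_overlay :: "'a::euclidean_space set \<Rightarrow> 'j set \<Rightarrow> ('a \<Rightarrow> 'j) \<Rightarrow> 'a set set" where
  "color_overlay A J f \<equiv> Ovl J (\<lambda>j. Vor (color_class A f j))"

lemma Inter_voronoi_domain_eq_site_cell:
  assumes "\<And>j. j \<in> J \<Longrightarrow> a j \<in> color_class A f j"
  shows "(\<Inter>j\<in>J. voronoi_domain (color_class A f j) (a j)) = site_cell A f (a ` J)"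
  using assms
  by (fastforce simp: voronoi_domain_def color_class_def site_cell_def nearest_sites_def)

lemma overlay_top_cells_Vor_iff:
  fixes A :: "'a::euclidean_space set"
  shows "c \<in> overlay_top_cells J (\<lambda>j. Vor (color_class A f j)) \<longleftrightarrow>
    (\<exists>T\<subseteq>A. bij_betw f T J \<and> c = site_cell A f T \<and> interior c \<noteq> {})"
proof
  assume "c \<in> overlay_top_cells J (\<lambda>j. Vor (color_class A f j))"
  then obtain \<nu> where \<nu>: "\<forall>j\<in>J. \<nu> j \<in> Vor (color_class A f j)" "c = (\<Inter>j\<in>J. \<nu> j)"
    and "interior c \<noteq> {}"
    unfolding overlay_top_cells_def by blast
  from \<nu>(1) obtain a where a: "\<And>j. j \<in> J \<Longrightarrow> a j \<in> color_class A f j"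
    "\<And>j. j \<in> J \<Longrightarrow> \<nu> j = voronoi_domain (color_class A f j) (a j)"
    unfolding Vor_def image_iff by metis
  have "c = site_cell A f (a ` J)"
    using \<nu>(2) a(2) Inter_voronoi_domain_eq_site_cell[OF a(1)] by simp
  moreover have "a ` J \<subseteq> A" using a(1) by (auto simp: color_class_def)
  moreover have "bij_betw f (a ` J) J"
    using a(1) by (intro bij_betw_byWitness[of _ a]) (auto simp: color_class_def)
  ultimately show "\<exists>T\<subseteq>A. bij_betw f T J \<and> c = site_cell A f T \<and> interior c \<noteq> {}"
    using \<open>interior c \<noteq> {}\<close> by blast
next
  assume "\<exists>T\<subseteq>A. bij_betw f T J \<and> c = site_cell A f T \<and> interior c \<noteq> {}"
  then obtain T where T: "T \<subseteq> A" "bij_betw f T J" and c: "c = site_cell A f T" "interior c \<noteq> {}"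
    by blast
  define a where "a = the_inv_into T f"
  have aJ: "a ` J = T"
    using bij_betw_the_inv_into[OF T(2)] by (simp add: a_def bij_betw_def)
  have a: "a j \<in> color_class A f j" if "j \<in> J" for j
    using T that aJ f_the_inv_into_f_bij_betw[OF T(2)] by (auto simp: a_def color_class_def)
  then have "(\<Inter>j\<in>J. voronoi_domain (color_class A f j) (a j)) = c"
    using Inter_voronoi_domain_eq_site_cell[of J a A f] aJ c(1) by simp
  then show "c \<in> overlay_top_cells J (\<lambda>j. Vor (color_class A f j))"
    using a c(2) unfolding overlay_top_cells_def Vor_def
    by (intro CollectI exI[of _ "\<lambda>j. voronoi_domain (color_class A f j) (a j)"]) auto
qed

lemma color_overlay_empty:
  assumes "\<not> J \<subseteq> f ` A"
  shows "color_overlay A J f = {}"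
proof -
  have "overlay_top_cells J (\<lambda>j. Vor (color_class A f j)) = {}"
    using assms by (fastforce simp: overlay_top_cells_Vor_iff bij_betw_def)
  then show ?thesis by (simp add: Ovl_def)
qed

lemma ex_inj_on_dist_in_open:
  fixes S :: "'a::euclidean_space set"
  assumes "finite S" "open U" "U \<noteq> {}"
  shows "\<exists>z\<in>U. inj_on (dist z) S"
proof -
  define N where "N = (\<Union>p\<in>S. \<Union>q\<in>S - {p}. {z. dist z p = dist z q})"
  have "negligible {z. dist z p = dist z q}" if "q \<noteq> p" for p q :: 'a
    unfolding dist_eq_iff_inner using that by (intro negligible_hyperplane) simp
  then have "negligible (\<Union>q\<in>S - {p}. {z. dist z p = dist z q})" for p
    using assms(1) by (intro negligible_Union) auto
  then have "negligible N"
    unfolding N_def using assms(1) by (intro negligible_Union) auto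
  then have "\<not> U \<subseteq> N"
    using open_not_negligible[OF assms(2,3)] negligible_subset by blast
  then obtain z where "z \<in> U" "z \<notin> N" by blast
  then show ?thesis by (intro bexI[of _ z] inj_onI) (auto simp: N_def)
qed

lemma mem_interior_cell_around:
  fixes A :: "'a::metric_space set"
  assumes fin: "locally_finite A" "finite (f ` A)" and inj: "inj_on f (nearest_sites A f z)"
  shows "z \<in> interior (cell_around A f z)"
proof -
  have "w \<in> cell_around A f z" if "nearest_sites A f w \<subseteq> nearest_sites A f z" for w
    using inj_on_image_eq_iff[OF inj that order_refl]
    by (simp add: image_nearest_sites[OF fin(1)] site_cell_def)
  then have "\<forall>\<^sub>F w in nhds z. w \<in> cell_around A f z"
    using eventually_nearest_sites_subset[OF fin, of z] by (auto elim: eventually_mono)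
  then show ?thesis
    unfolding eventually_nhds by (auto intro: interiorI)
qed

text \<open>A generic point near \<open>y\<close> has exactly one nearest site of each color, so it is interior to a
  top-dimensional cell. This cell contains \<open>y\<close>, because sets of nearest sites do not grow near \<open>y\<close>.\<close>

lemma cell_around_in_color_overlay:
  fixes A :: "'a::euclidean_space set"
  assumes fin: "locally_finite A" "finite (f ` A)"
  shows "cell_around A f y \<in> color_overlay A (f ` A) f"
proof -
  let ?M = "nearest_sites A f"
  obtain U where U: "open U" "y \<in> U" "\<forall>z\<in>U. ?M z \<subseteq> ?M y"
    using eventually_nearest_sites_subset[OF fin, of y] unfolding eventually_nhds by blast
  obtain z where z: "z \<in> U" "inj_on (dist z) (?M y)"
    using ex_inj_on_dist_in_open[OF finite_nearest_sites[OF fin] U(1)] U(2) by blast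
  have zy: "?M z \<subseteq> ?M y" using U(3) z(1) by blast
  have inj: "inj_on f (?M z)"
  proof (rule inj_onI)
    fix p q assume pq: "p \<in> ?M z" "q \<in> ?M z" "f p = f q"
    then show "p = q" using zy by (intro inj_onD[OF z(2) nearest_sites_dist_eq[OF pq]]) auto
  qed
  have "cell_around A f z \<in> overlay_top_cells (f ` A) (\<lambda>j. Vor (color_class A f j))"
    unfolding overlay_top_cells_Vor_iff
    using inj nearest_sites_subset mem_interior_cell_around[OF fin inj]
    by (intro exI[of _ "?M z"]) (auto simp: bij_betw_def image_nearest_sites[OF fin(1)])
  moreover have "cell_around A f y face_of cell_around A f z"
    using fin(1) zy by (intro cell_around_face_of) (simp_all add: image_nearest_sites)
  moreover have "y \<in> cell_around A f y" by (simp add: site_cell_def)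
  ultimately show ?thesis by (auto simp: Ovl_def)
qed

proposition color_overlay_eq_range_cell_around:
  fixes A :: "'a::euclidean_space set"
  assumes fin: "locally_finite A" "finite (f ` A)"
  shows "color_overlay A (f ` A) f = range (cell_around A f)"
proof (intro equalityI subsetI)
  fix F assume "F \<in> color_overlay A (f ` A) f"
  then obtain T where F: "F \<noteq> {}" "F face_of site_cell A f T" and T: "T \<subseteq> A" "bij_betw f T (f ` A)"
    unfolding Ovl_def mem_Collect_eq Bex_def overlay_top_cells_Vor_iff by blast
  obtain y where "y \<in> rel_interior F"
    using F face_of_imp_convex rel_interior_eq_empty by blast
  then have "F = cell_around A f y"
    using F(2) T by (intro face_of_site_cell_eq_cell_around[OF fin]) (auto simp: bij_betw_def)
  then show "F \<in> range (cell_around A f)" by blast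
qed (use cell_around_in_color_overlay[OF fin] in blast)

section \<open>Counting the cells near a point\<close>

text \<open>Every cell with a vertex \<open>v\<close> is the cell around points arbitrarily close to \<open>v\<close>. Restricting
  \<open>y\<close> to a neighborhood of the ball makes the set depend only on the nearest sites there.\<close>

definition vertex_cell_sites ::
    "'a::euclidean_space set \<Rightarrow> ('a \<Rightarrow> 'j) \<Rightarrow> 'a \<Rightarrow> real \<Rightarrow> 'a set set" where
  "vertex_cell_sites A f x \<rho> = nearest_sites A f ` {y \<in> ball x (\<rho> + 1). \<exists>v\<in>cball x \<rho>.
     nearest_sites A f y \<subseteq> nearest_sites A f v \<and> overlay_vertex A f v}"

lemma cells_with_vertex_in_cball_eq:
  fixes A :: "'a::euclidean_space set"
  assumes fin: "locally_finite A" "finite (f ` A)"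
  shows "{F \<in> color_overlay A (f ` A) f. \<exists>v\<in>cball x \<rho>. v extreme_point_of F} =
    site_cell A f ` vertex_cell_sites A f x \<rho>" (is "?L = ?R")
proof (intro equalityI subsetI)
  fix F assume "F \<in> ?L"
  then obtain y v where F: "F = cell_around A f y" and v: "v \<in> cball x \<rho>"
    "nearest_sites A f y \<subseteq> nearest_sites A f v" "overlay_vertex A f v"
    unfolding color_overlay_eq_range_cell_around[OF fin]
    by (auto simp: extreme_point_of_cell_around_iff[OF fin])
  obtain z where z: "dist v z < 1" "nearest_sites A f z = nearest_sites A f y"
  proof (cases "v = y")
    case False
    then have "v \<in> closure (open_segment v y)" by simp
    then obtain z where "z \<in> open_segment v y" "dist z v < 1"
      using closure_approachable zero_less_one by blast
    then show ?thesis
      using that nearest_sites_open_segment[OF fin(1) v(2)] by (simp add: dist_commute)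
  qed (use that[of y] in simp)
  have "dist x z < \<rho> + 1" using v(1) z(1) dist_triangle[of x z v] by simp
  with v z(2) have "nearest_sites A f z \<in> vertex_cell_sites A f x \<rho>"
    unfolding vertex_cell_sites_def by (intro imageI) auto
  with F z(2) show "F \<in> ?R" by auto
next
  fix F assume "F \<in> ?R"
  then show "F \<in> ?L"
    unfolding color_overlay_eq_range_cell_around[OF fin] vertex_cell_sites_def
    by (auto simp: extreme_point_of_cell_around_iff[OF fin])
qed

lemma num_cells_with_vertex_in_cball_eq:
  fixes A :: "'a::euclidean_space set"
  assumes "locally_finite A" "finite (f ` A)"
  shows "num_cells_with_vertex_in (cball x \<rho>) (color_overlay A (f ` A) f) =
    emeasure (count_space UNIV) (vertex_cell_sites A f x \<rho>)"
proof -
  have "inj_on (site_cell A f) (vertex_cell_sites A f x \<rho>)"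
    using inj_on_site_cell by (rule inj_on_subset) (auto simp: vertex_cell_sites_def)
  then show ?thesis
    unfolding num_cells_with_vertex_in_def cells_with_vertex_in_cball_eq[OF assms]
    by (cases "finite (vertex_cell_sites A f x \<rho>)") (auto simp: card_image finite_image_iff)
qed

lemma vertex_cell_sites_cong:
  fixes A :: "'a::euclidean_space set" and f g :: "'a \<Rightarrow> 'j"
  assumes "0 \<le> \<rho>" and eq: "\<And>z. z \<in> ball x (\<rho> + 1) \<Longrightarrow> nearest_sites A f z = nearest_sites A g z"
  shows "vertex_cell_sites A f x \<rho> = vertex_cell_sites A g x \<rho>"
proof -
  have "nearest_sites A f v = nearest_sites A g v \<and> (overlay_vertex A f v \<longleftrightarrow> overlay_vertex A g v)"
    if "v \<in> cball x \<rho>" for v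
    using eq that by (intro conjI overlay_vertex_cong[of "ball x (\<rho> + 1)"]) auto
  then show ?thesis
    unfolding vertex_cell_sites_def using eq
    by (intro image_cong Collect_cong conj_cong bex_cong refl) auto
qed

lemma num_cells_with_vertex_in_cball_cong:
  fixes A :: "'a::euclidean_space set" and f g :: "'a \<Rightarrow> 'j"
  assumes locfin: "locally_finite A" and J: "finite J" "f ` A \<subseteq> J" "g ` A \<subseteq> J" and "0 \<le> \<rho>"
    and colors: "J \<subseteq> f ` (A \<inter> cball x \<tau>)"
    and eq: "\<And>a. a \<in> A \<inter> cball x (\<tau> + 2 * (\<rho> + 1)) \<Longrightarrow> f a = g a"
  shows "num_cells_with_vertex_in (cball x \<rho>) (color_overlay A J f) =
    num_cells_with_vertex_in (cball x \<rho>) (color_overlay A J g)"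
proof -
  let ?B = "A \<inter> cball x (\<tau> + 2 * (\<rho> + 1))"
  have "f ` (A \<inter> cball x \<tau>) = g ` (A \<inter> cball x \<tau>)"
    using eq \<open>0 \<le> \<rho>\<close> by (intro image_cong) auto
  then have colors': "J \<subseteq> g ` (A \<inter> cball x \<tau>)" using colors by simp
  have "nearest_sites A f z = nearest_sites A g z" if z: "z \<in> ball x (\<rho> + 1)" for z
  proof -
    have "nearest_sites A f z = nearest_sites ?B f z"
      using z J(2) colors by (intro nearest_sites_Int_cball) auto
    also have "\<dots> = nearest_sites ?B g z" using eq by (rule nearest_sites_cong)
    also have "\<dots> = nearest_sites A g z"
      using z J(3) colors' by (intro nearest_sites_Int_cball[symmetric]) auto
    finally show ?thesis .
  qed
  then have "vertex_cell_sites A f x \<rho> = vertex_cell_sites A g x \<rho>"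
    by (intro vertex_cell_sites_cong \<open>0 \<le> \<rho>\<close>)
  moreover have "f ` A = J" "g ` A = J" using J colors colors' by auto
  ultimately show ?thesis
    using J(1) num_cells_with_vertex_in_cball_eq[OF locfin, of f]
      num_cells_with_vertex_in_cball_eq[OF locfin, of g] by simp
qed

lemma card_small_subsets_le:
  assumes "finite Q"
  shows "card {T. T \<subseteq> Q \<and> card T \<le> k} \<le> (card Q + 1) ^ k"
proof -
  let ?X = "{xs. set xs \<subseteq> Q \<and> length xs \<le> k}"
  have "{T. T \<subseteq> Q \<and> card T \<le> k} \<subseteq> set ` ?X"
  proof
    fix T assume T: "T \<in> {T. T \<subseteq> Q \<and> card T \<le> k}"
    then obtain xs where "set xs = T" "distinct xs"
      using finite_distinct_list finite_subset assms by (metis mem_Collect_eq)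
    then show "T \<in> set ` ?X" using T by (intro image_eqI[of _ _ xs]) (auto simp: distinct_card)
  qed
  then have "card {T. T \<subseteq> Q \<and> card T \<le> k} \<le> card ?X"
    using finite_lists_length_le[OF assms] by (rule surj_card_le[rotated])
  also have "\<dots> = (\<Sum>i\<le>k. card Q ^ i)" by (rule card_lists_length_le[OF assms])
  also have "\<dots> \<le> (\<Sum>i\<le>k. (k choose i) * card Q ^ i)"
    by (intro sum_mono) (simp add: Suc_le_eq)
  also have "\<dots> = (card Q + 1) ^ k" using binomial[of "card Q" 1 k] by simp
  finally show ?thesis .
qed

lemma num_cells_with_vertex_in_cball_le:
  fixes A :: "'a::euclidean_space set"
  assumes locfin: "locally_finite A" and J: "finite J" "f ` A \<subseteq> J"
    and colors: "J \<subseteq> f ` (A \<inter> cball x \<tau>)"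
  shows "num_cells_with_vertex_in (cball x \<rho>) (color_overlay A J f)
    \<le> of_nat ((card (A \<inter> cball x (\<tau> + 2 * \<rho>)) + 1) ^ (DIM('a) + card J))"
proof -
  let ?Q = "A \<inter> cball x (\<tau> + 2 * \<rho>)"
  let ?X = "{U. U \<subseteq> ?Q \<and> card U \<le> DIM('a) + card J}"
  have image_eq: "f ` A = J" using J(2) colors by blast
  have finite_Q: "finite ?Q" using locfin by (simp add: locally_finite_def)
  have finite_X: "finite ?X" by (intro finite_Collect_conjI disjI1 finite_Collect_subsets finite_Q)
  have "{F \<in> color_overlay A J f. \<exists>v\<in>cball x \<rho>. v extreme_point_of F} \<subseteq> site_cell A f ` ?X"
  proof
    fix F assume "F \<in> {F \<in> color_overlay A J f. \<exists>v\<in>cball x \<rho>. v extreme_point_of F}"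
    then obtain y v where F: "F = cell_around A f y" and v: "v \<in> cball x \<rho>" "v \<in> F"
      using color_overlay_eq_range_cell_around[OF locfin, of f] J(1) image_eq
      by (auto simp: extreme_point_of_def)
    obtain U where "U \<subseteq> nearest_sites A f y" "card U \<le> DIM('a) + card J"
      "site_cell A f U = cell_around A f y"
      using ex_small_site_cell_eq_cell_around[OF locfin, of f y] image_eq by blast
    moreover have "nearest_sites A f y \<subseteq> nearest_sites A f v"
      using v(2) F by (simp add: site_cell_def)
    moreover have "nearest_sites A f v \<subseteq> ?Q"
      using v(1) colors image_eq by (intro nearest_sites_subset_cball) auto
    ultimately show "F \<in> site_cell A f ` ?X" using F by blast
  qed
  then have "num_cells_with_vertex_in (cball x \<rho>) (color_overlay A J f)
      \<le> emeasure (count_space UNIV) (site_cell A f ` ?X)"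
    unfolding num_cells_with_vertex_in_def by (intro emeasure_mono) auto
  also have "\<dots> = of_nat (card (site_cell A f ` ?X))"
    using finite_X by (intro emeasure_count_space_finite) auto
  also have "\<dots> \<le> of_nat ((card ?Q + 1) ^ (DIM('a) + card J))"
    by (intro of_nat_mono order_trans[OF card_image_le[OF finite_X]] card_small_subsets_le finite_Q)
  finally show ?thesis .
qed

lemma num_cells_with_vertex_in_UN_le:
  assumes "finite I" "\<Omega> \<subseteq> (\<Union>i\<in>I. B i)"
  shows "num_cells_with_vertex_in \<Omega> K \<le> (\<Sum>i\<in>I. num_cells_with_vertex_in (B i) K)"
proof -
  let ?C = "\<lambda>\<Omega>. {F \<in> K. \<exists>v\<in>\<Omega>. v extreme_point_of F}"
  have "?C \<Omega> \<subseteq> (\<Union>i\<in>I. ?C (B i))" using assms(2) by blast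
  then have "num_cells_with_vertex_in \<Omega> K \<le> emeasure (count_space UNIV) (\<Union>i\<in>I. ?C (B i))"
    unfolding num_cells_with_vertex_in_def by (intro emeasure_mono) auto
  also have "\<dots> \<le> (\<Sum>i\<in>I. num_cells_with_vertex_in (B i) K)"
    unfolding num_cells_with_vertex_in_def
    using assms(1) by (intro emeasure_subadditive_finite) auto
  finally show ?thesis .
qed

section \<open>Delone sets\<close>

lemma delone_dist_ge:
  fixes A :: "'a::real_normed_vector set"
  assumes "delone r R A" "p \<in> A" "q \<in> A" "p \<noteq> q"
  shows "2 * r \<le> dist p q"
proof (rule ccontr)
  assume "\<not> 2 * r \<le> dist p q"
  then have "p \<in> A \<inter> ball (midpoint p q) r" "q \<in> A \<inter> ball (midpoint p q) r"
    using assms by (auto simp: dist_midpoint)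
  then show False using assms unfolding delone_def by blast
qed

lemma card_separated_subset_cball_le:
  fixes S :: "'a::euclidean_space set"
  assumes S: "finite S" "S \<subseteq> cball x \<rho>" and sep: "pairwise (\<lambda>p q. 2 * r \<le> dist p q) S"
    and r_pos: "0 < r" and rho_nonneg: "0 \<le> \<rho>"
  shows "real (card S) \<le> ((\<rho> + r) / r) ^ DIM('a)"
proof -
  let ?u = "unit_ball_vol (real DIM('a))"
  have "disjoint_family_on (\<lambda>p. ball p r) S"
    using sep by (auto simp: disjoint_family_on_def pairwise_def intro!: disjoint_ballI)
  then have "(\<Sum>p\<in>S. emeasure lborel (ball p r)) = emeasure lborel (\<Union>p\<in>S. ball p r)"
    using S by (intro sum_emeasure) auto
  also have "\<dots> \<le> emeasure lborel (cball x (\<rho> + r))"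
  proof (intro emeasure_mono UN_least subsetI)
    fix p z assume "p \<in> S" "z \<in> ball p r"
    then have "dist x p \<le> \<rho>" "dist p z < r" using S by auto
    then show "z \<in> cball x (\<rho> + r)" using dist_triangle[of x z p] by simp
  qed simp
  finally have "ennreal (real (card S) * (?u * r ^ DIM('a))) \<le> ennreal (?u * (\<rho> + r) ^ DIM('a))"
    using r_pos rho_nonneg
    by (simp add: emeasure_ball emeasure_cball ennreal_mult' ennreal_of_nat_eq_real_of_nat)
  then have "?u * (real (card S) * r ^ DIM('a)) \<le> ?u * (\<rho> + r) ^ DIM('a)"
    using r_pos rho_nonneg by (subst (asm) ennreal_le_iff) (auto simp: mult_ac)
  then have "real (card S) * r ^ DIM('a) \<le> (\<rho> + r) ^ DIM('a)"
    by (subst (asm) mult_le_cancel_left_pos) auto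
  then show ?thesis using r_pos by (simp add: power_divide pos_le_divide_eq)
qed

lemma delone_card_subset_cball_le:
  fixes A :: "'a::euclidean_space set"
  assumes "delone r R A" "0 < r" "0 \<le> \<rho>" "S \<subseteq> A \<inter> cball x \<rho>" "finite S"
  shows "real (card S) \<le> ((\<rho> + r) / r) ^ DIM('a)"
  using assms delone_dist_ge[OF assms(1)]
  by (intro card_separated_subset_cball_le) (auto simp: pairwise_def)

lemma delone_imp_locally_finite:
  fixes A :: "'a::euclidean_space set"
  assumes "delone r R A" "0 < r"
  shows "locally_finite A"
  unfolding locally_finite_def
proof (intro allI)
  fix x \<rho>
  show "finite (A \<inter> cball x \<rho>)"
  proof (cases "0 \<le> \<rho>")
    case True
    have "card S \<le> nat \<lfloor>((\<rho> + r) / r) ^ DIM('a)\<rfloor>" if "S \<subseteq> A \<inter> cball x \<rho>" "finite S" for S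
      using delone_card_subset_cball_le[OF assms True that] by (rule le_nat_floor)
    then show ?thesis
      using finite_if_finite_subsets_card_bdd by blast
  qed simp
qed

lemma delone_card_cball_ge:
  fixes A :: "'a::euclidean_space set"
  assumes del: "delone r R A" and r_pos: "0 < r" and R_pos: "0 < R"
  shows "t \<le> card (A \<inter> cball x (3 * R * real t))"
proof -
  obtain e :: 'a where e: "norm e = 1" using vector_choose_size zero_le_one by blast
  define c where "c i = x + (3 * R * real i) *\<^sub>R e" for i :: nat
  have "\<exists>p. p \<in> A \<inter> cball (c i) R" for i using del unfolding delone_def by blast
  then obtain p where p: "\<And>i. p i \<in> A \<inter> cball (c i) R" by metis
  have "inj p"
  proof (rule injI, rule ccontr)
    fix i j assume ij: "p i = p j" "i \<noteq> j"
    have "c i - c j = (3 * R * (real i - real j)) *\<^sub>R e" by (simp add: c_def algebra_simps)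
    then have "dist (c i) (c j) = 3 * R * \<bar>real i - real j\<bar>"
      using e R_pos by (simp add: dist_norm abs_mult)
    moreover have "1 \<le> \<bar>real i - real j\<bar>" using ij by linarith
    ultimately have "3 * R \<le> dist (c i) (c j)" using R_pos by simp
    moreover have "dist (c i) (c j) \<le> R + R"
      using p[of i] p[of j] ij by (intro dist_triangle_le[of _ "p i"]) (simp add: dist_commute)
    ultimately show False using R_pos by simp
  qed
  moreover have "p i \<in> A \<inter> cball x (3 * R * real t)" if "i < t" for i
  proof -
    have "dist x (c i) = 3 * R * real i" using e R_pos by (simp add: c_def dist_norm)
    then have "dist x (p i) \<le> 3 * R * real i + R"
      using p[of i] dist_triangle[of x "p i" "c i"] by simp
    also have "\<dots> \<le> 3 * R * (real i + 1)" using R_pos by (simp add: algebra_simps)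
    also have "\<dots> \<le> 3 * R * real t" using R_pos that by (intro mult_left_mono) auto
    finally show ?thesis using p by auto
  qed
  ultimately have "card {..<t} \<le> card (A \<inter> cball x (3 * R * real t))"
    using delone_imp_locally_finite[OF del r_pos]
    by (intro card_inj_on_le[of p]) (auto simp: locally_finite_def inj_on_def)
  then show ?thesis by simp
qed

lemma delone_cball_subset_UN:
  fixes A :: "'a::real_normed_vector set"
  assumes del: "delone r R A" and R: "0 < R" "R \<le> \<omega>"
  shows "cball x \<omega> \<subseteq> (\<Union>a\<in>A \<inter> cball x \<omega>. cball a (2 * R))"
proof
  fix v assume v: "v \<in> cball x \<omega>"
  define w where "w = x + (1 - R / \<omega>) *\<^sub>R (v - x)"
  have R\<omega>: "0 \<le> R / \<omega>" "R / \<omega> \<le> 1" and "norm (v - x) \<le> \<omega>"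
    using R v by (auto simp: dist_norm norm_minus_commute)
  have "norm (w - x) = (1 - R / \<omega>) * norm (v - x)" using R\<omega> by (simp add: w_def)
  also have "\<dots> \<le> (1 - R / \<omega>) * \<omega>" using R\<omega> \<open>norm (v - x) \<le> \<omega>\<close> by (intro mult_left_mono) auto
  also have "\<dots> = \<omega> - R" using R by (simp add: left_diff_distrib)
  finally have wx: "dist x w \<le> \<omega> - R" by (simp add: dist_norm norm_minus_commute)
  have "v - w = (R / \<omega>) *\<^sub>R (v - x)" by (simp add: w_def algebra_simps)
  then have "norm (v - w) = R / \<omega> * norm (v - x)" using R by simp
  also have "\<dots> \<le> R / \<omega> * \<omega>" using R\<omega> \<open>norm (v - x) \<le> \<omega>\<close> by (intro mult_left_mono) auto
  finally have vw: "dist w v \<le> R" using R by (simp add: dist_norm norm_minus_commute)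
  obtain a where a: "a \<in> A" "dist w a \<le> R" using del unfolding delone_def by fastforce
  have "dist x a \<le> \<omega>" using wx a dist_triangle[of x a w] by simp
  moreover have "dist a v \<le> 2 * R" using vw a dist_triangle3[of a v w] by simp
  ultimately show "v \<in> (\<Union>a\<in>A \<inter> cball x \<omega>. cball a (2 * R))" using a by auto
qed

section \<open>Random colorings\<close>

lemma space_random_coloring: "space (random_coloring A J) = A \<rightarrow>\<^sub>E J"
  by (simp add: random_coloring_def space_PiM space_uniform_count_measure)

lemma prob_space_random_coloring:
  assumes "finite J" "J \<noteq> {}"
  shows "prob_space (random_coloring A J)"
  unfolding random_coloring_def
  using assms by (intro prob_space_PiM prob_space_uniform_count_measure)

lemma sets_random_coloring_finitely_determined:
  assumes Q: "finite Q" "Q \<subseteq> A" and J: "finite J"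
    and det: "\<And>f g. \<lbrakk>f \<in> A \<rightarrow>\<^sub>E J; g \<in> A \<rightarrow>\<^sub>E J; \<And>a. a \<in> Q \<Longrightarrow> f a = g a; P f\<rbrakk> \<Longrightarrow> P g"
  shows "{f \<in> space (random_coloring A J). P f} \<in> sets (random_coloring A J)"
proof -
  define W where "W = (\<lambda>f. restrict f Q) ` {f \<in> A \<rightarrow>\<^sub>E J. P f}"
  have "(\<lambda>f. restrict f Q) \<in> random_coloring A J \<rightarrow>\<^sub>M PiM Q (\<lambda>_. count_space J)"
    unfolding random_coloring_def
    using Q(2) by (rule measurable_restrict_subset') (simp add: sets_uniform_count_measure)
  also have "PiM Q (\<lambda>_. count_space J) = count_space (Q \<rightarrow>\<^sub>E J)"
    using Q(1) J by (intro count_space_PiM_finite countable_finite)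
  finally have "(\<lambda>f. restrict f Q) \<in> random_coloring A J \<rightarrow>\<^sub>M count_space (Q \<rightarrow>\<^sub>E J)" .
  moreover have "W \<in> sets (count_space (Q \<rightarrow>\<^sub>E J))" using Q(2) by (auto simp: W_def)
  ultimately have "(\<lambda>f. restrict f Q) -` W \<inter> space (random_coloring A J)
      \<in> sets (random_coloring A J)"
    by (rule measurable_sets)
  moreover have "(\<lambda>f. restrict f Q) -` W \<inter> space (random_coloring A J) =
      {f \<in> space (random_coloring A J). P f}"
  proof (intro equalityI subsetI)
    fix f assume "f \<in> (\<lambda>f. restrict f Q) -` W \<inter> space (random_coloring A J)"
    then obtain g where g: "g \<in> A \<rightarrow>\<^sub>E J" "P g" and f: "f \<in> A \<rightarrow>\<^sub>E J" "restrict f Q = restrict g Q"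
      by (auto simp: W_def space_random_coloring)
    have "g a = f a" if "a \<in> Q" for a
      using fun_cong[OF f(2), of a] that by simp
    then show "f \<in> {f \<in> space (random_coloring A J). P f}"
      using det[OF g(1) f(1) _ g(2)] f(1) by (simp add: space_random_coloring)
  qed (auto simp: W_def space_random_coloring)
  ultimately show ?thesis by simp
qed

lemma sets_random_coloring_all_colors:
  assumes "finite Q" "Q \<subseteq> A" "finite J"
  shows "{f \<in> space (random_coloring A J). J \<subseteq> f ` Q} \<in> sets (random_coloring A J)"
proof (rule sets_random_coloring_finitely_determined[OF assms])
  fix f g :: "'a \<Rightarrow> 'b" assume "\<And>a. a \<in> Q \<Longrightarrow> f a = g a" "J \<subseteq> f ` Q"
  then show "J \<subseteq> g ` Q" using image_cong[of Q Q f g] by simp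
qed

lemma emeasure_random_coloring_avoid_color:
  assumes Q: "finite Q" "Q \<subseteq> A" and J: "finite J" "j \<in> J"
  shows "emeasure (random_coloring A J) {f \<in> space (random_coloring A J). j \<notin> f ` Q}
    = ennreal ((1 - 1 / real (card J)) ^ card Q)"
proof -
  let ?U = "uniform_count_measure J"
  have "J \<noteq> {}" using J(2) by blast
  with J(1) have card: "1 \<le> card J" by (simp add: Suc_le_eq card_gt_0_iff)
  have "prob_space ?U" using J(1) \<open>J \<noteq> {}\<close> by (rule prob_space_uniform_count_measure)
  then interpret product_prob_space "\<lambda>_. ?U" A
    by (rule product_prob_spaceI)
  have "{f \<in> space (random_coloring A J). j \<notin> f ` Q} =
      {f \<in> space (random_coloring A J). \<forall>a\<in>Q. f a \<in> J - {j}}"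
    using Q by (auto simp: space_random_coloring)
  also have "emeasure (random_coloring A J) \<dots> = (\<Prod>a\<in>Q. emeasure ?U (J - {j}))"
    unfolding random_coloring_def using Q
    by (intro emeasure_PiM_Collect) (auto simp: sets_uniform_count_measure)
  also have "emeasure ?U (J - {j}) = ennreal (1 - 1 / real (card J))"
    using J \<open>J \<noteq> {}\<close> card
    by (simp add: emeasure_uniform_count_measure of_nat_diff diff_divide_distrib)
  also have "(\<Prod>a\<in>Q. ennreal (1 - 1 / real (card J))) = ennreal ((1 - 1 / real (card J)) ^ card Q)"
    using card by (simp add: ennreal_power)
  finally show ?thesis .
qed

lemma emeasure_random_coloring_missing_color_le:
  assumes Q: "finite Q" "Q \<subseteq> A" and J: "finite J" "J \<noteq> {}"
  shows "emeasure (random_coloring A J) {f \<in> space (random_coloring A J). \<not> J \<subseteq> f ` Q}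
    \<le> ennreal (card J * exp (- (card Q / card J)))"
proof -
  let ?P = "random_coloring A J" and ?E = "\<lambda>j. {f \<in> space (random_coloring A J). j \<notin> f ` Q}"
  have card: "1 \<le> card J" using J by (simp add: Suc_le_eq card_gt_0_iff)
  have sets: "?E j \<in> sets ?P" for j
    using Q J(1) by (intro sets_random_coloring_finitely_determined[of Q]) (auto simp: image_iff)
  have avoid: "emeasure ?P (?E j) \<le> ennreal (exp (- (card Q / card J)))" if "j \<in> J" for j
  proof -
    have "(1 - 1 / real (card J)) ^ card Q \<le> exp (- (1 / card J)) ^ card Q"
      using card exp_ge_add_one_self[of "- (1 / real (card J))"] by (intro power_mono) auto
    also have "\<dots> = exp (- (card Q / card J))" by (simp flip: exp_of_nat_mult)
    finally show ?thesis
      using emeasure_random_coloring_avoid_color[OF Q J(1) that] by (simp add: ennreal_leI)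
  qed
  have "{f \<in> space ?P. \<not> J \<subseteq> f ` Q} = (\<Union>j\<in>J. ?E j)" by auto
  also have "emeasure ?P \<dots> \<le> (\<Sum>j\<in>J. emeasure ?P (?E j))"
    using J(1) sets by (intro emeasure_subadditive_finite) auto
  also have "\<dots> \<le> (\<Sum>j\<in>J. ennreal (exp (- (card Q / card J))))"
    using avoid by (rule sum_mono)
  also have "\<dots> = ennreal (card J * exp (- (card Q / card J)))"
    by (simp add: ennreal_mult' ennreal_of_nat_eq_real_of_nat)
  finally show ?thesis .
qed

lemma ex_nat_colors_if_num_cells_with_vertex_in_nonzero:
  fixes A :: "'a::euclidean_space set"
  assumes "finite J" "num_cells_with_vertex_in \<Omega> (color_overlay A J f) \<noteq> 0" "0 < c"
  shows "\<exists>t::nat. J \<subseteq> f ` (A \<inter> cball x (c * real t))"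
proof -
  have "J \<subseteq> f ` A"
    using assms(2) color_overlay_empty[of J f A]
    by (cases "J \<subseteq> f ` A") (simp_all add: num_cells_with_vertex_in_def)
  then obtain \<tau> where \<tau>: "J \<subseteq> f ` (A \<inter> cball x \<tau>)"
    using finite_subset_image_imp_Int_cball[OF assms(1)] by blast
  obtain t :: nat where "\<tau> < real t * c" using reals_Archimedean3[OF \<open>0 < c\<close>] by blast
  then have "A \<inter> cball x \<tau> \<subseteq> A \<inter> cball x (c * real t)" by (auto simp: mult.commute)
  with \<tau> show ?thesis by (meson image_mono order_trans)
qed

lemma borel_measurable_num_cells_with_vertex_in_cball:
  fixes A :: "'a::euclidean_space set"
  assumes locfin: "locally_finite A" and J: "finite J" and rho_nonneg: "0 \<le> \<rho>"
  shows "(\<lambda>f. num_cells_with_vertex_in (cball x \<rho>) (color_overlay A J f))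
    \<in> borel_measurable (random_coloring A J)" (is "?N \<in> _")
proof (rule measurableI)
  let ?P = "random_coloring A J"
  fix B :: "ennreal set" assume "B \<in> sets borel"
  define E where "E t f \<longleftrightarrow> J \<subseteq> f ` (A \<inter> cball x (real t))" for t :: nat and f :: "'a \<Rightarrow> 'b"
  have fin: "finite (A \<inter> cball x \<tau>)" for \<tau> using locfin by (simp add: locally_finite_def)
  have "{f \<in> space ?P. E t f \<and> ?N f \<in> B} \<in> sets ?P" for t
  proof (rule sets_random_coloring_finitely_determined[OF fin[of "t + 2 * (\<rho> + 1)"] _ J])
    fix f g assume fg: "f \<in> A \<rightarrow>\<^sub>E J" "g \<in> A \<rightarrow>\<^sub>E J" and f: "E t f \<and> ?N f \<in> B"
      and eq: "\<And>a. a \<in> A \<inter> cball x (t + 2 * (\<rho> + 1)) \<Longrightarrow> f a = g a"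
    have "f ` (A \<inter> cball x (real t)) = g ` (A \<inter> cball x (real t))"
      using eq rho_nonneg by (intro image_cong) auto
    moreover have "?N f = ?N g"
      using fg f eq
      by (intro num_cells_with_vertex_in_cball_cong[OF locfin J _ _ rho_nonneg]) (auto simp: E_def)
    ultimately show "E t g \<and> ?N g \<in> B" using f by (simp add: E_def)
  qed simp
  moreover have "{f \<in> space ?P. E t f} \<in> sets ?P" for t
    unfolding E_def using fin J by (intro sets_random_coloring_all_colors) auto
  moreover have "?N -` B \<inter> space ?P = (\<Union>t. {f \<in> space ?P. E t f \<and> ?N f \<in> B}) \<union>
      (if 0 \<in> B then space ?P - (\<Union>t. {f \<in> space ?P. E t f}) else {})"
  proof -
    have "?N f = 0" if "\<And>t. \<not> E t f" for f
      using that ex_nat_colors_if_num_cells_with_vertex_in_nonzero[OF J, of "cball x \<rho>" A f 1 x]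
      by (auto simp: E_def)
    then show ?thesis by (auto split: if_splits) metis+
  qed
  ultimately show "?N -` B \<inter> space ?P \<in> sets ?P" by auto
qed simp

section \<open>Expected number of cells\<close>

lemma nn_integral_le_suminf_first_time:
  fixes c :: "nat \<Rightarrow> ennreal"
  assumes E: "\<And>t. {\<omega> \<in> space M. E t \<omega>} \<in> sets M"
    and le: "\<And>t \<omega>. \<lbrakk>\<omega> \<in> space M; E t \<omega>\<rbrakk> \<Longrightarrow> N \<omega> \<le> c t"
    and ex: "\<And>\<omega>. \<lbrakk>\<omega> \<in> space M; N \<omega> \<noteq> 0\<rbrakk> \<Longrightarrow> \<exists>t. E t \<omega>"
  shows "(\<integral>\<^sup>+\<omega>. N \<omega> \<partial>M) \<le> c 0 * emeasure M (space M) +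
    (\<Sum>t. c (Suc t) * emeasure M {\<omega> \<in> space M. \<not> E t \<omega>})"
proof -
  define B where "B t = {\<omega> \<in> space M. \<not> E t \<omega>}" for t
  have [measurable]: "B t \<in> sets M" for t unfolding B_def using E by (rule sets.sets_Collect_neg)
  have "N \<omega> \<le> c 0 + (\<Sum>t. c (Suc t) * indicator (B t) \<omega>)" if \<omega>: "\<omega> \<in> space M" for \<omega>
  proof (cases "N \<omega> = 0")
    case False
    define t where "t = (LEAST t. E t \<omega>)"
    have E: "E t \<omega>" and least: "\<And>i. i < t \<Longrightarrow> \<not> E i \<omega>"
      using ex[OF \<omega> False] unfolding t_def by (auto intro: LeastI_ex dest: not_less_Least)
    show ?thesis
    proof (cases t)
      case 0
      then show ?thesis using le[OF \<omega> E] by (simp add: add_increasing2)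
    next
      case (Suc i)
      have "N \<omega> \<le> c (Suc i)" using le[OF \<omega> E] Suc by simp
      also have "\<dots> = (\<Sum>t\<in>{i}. c (Suc t) * indicator (B t) \<omega>)"
        using \<omega> least[of i] Suc by (simp add: B_def)
      also have "\<dots> \<le> (\<Sum>t. c (Suc t) * indicator (B t) \<omega>)" by (intro sum_le_suminf) auto
      finally show ?thesis by (simp add: add_increasing)
    qed
  qed simp
  then have "(\<integral>\<^sup>+\<omega>. N \<omega> \<partial>M) \<le> (\<integral>\<^sup>+\<omega>. c 0 + (\<Sum>t. c (Suc t) * indicator (B t) \<omega>) \<partial>M)"
    by (rule nn_integral_mono)
  also have "\<dots> = c 0 * emeasure M (space M) + (\<Sum>t. c (Suc t) * emeasure M (B t))"
    by (simp add: nn_integral_add nn_integral_suminf nn_integral_cmult_indicator)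
  finally show ?thesis by (simp only: B_def)
qed

lemma summable_poly_times_exp:
  fixes p :: "real poly"
  assumes "0 < c"
  shows "summable (\<lambda>t. poly p (real t) * exp (- c * real t))"
proof -
  have "summable (\<lambda>t. real t ^ i * exp (- c * real t))" for i
  proof (rule summable_comparison_test_bigo)
    show "(\<lambda>t. real t ^ i * exp (- c * real t)) \<in> O(\<lambda>t. exp (- (c / 2) * real t))"
      using assms by real_asymp
    have "norm (exp (- (c / 2) * real t)) = exp (- (c / 2)) ^ t" for t
      by (simp add: mult_ac flip: exp_of_nat_mult)
    then show "summable (\<lambda>t. norm (exp (- (c / 2) * real t)))"
      using assms by (simp add: summable_geometric)
  qed
  then have "summable (\<lambda>t. \<Sum>i\<le>degree p. coeff p i * (real t ^ i * exp (- c * real t)))"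
    by (intro summable_sum summable_mult)
  then show ?thesis by (simp add: poly_altdef sum_distrib_right mult.assoc)
qed

text \<open>At most \<open>((\<tau> + 2 * \<rho> + r) / r) ^ d\<close> sites fit into a ball of radius \<open>\<tau> + 2 * \<rho>\<close>, and a cell is
  determined by at most \<open>d + m\<close> of them.\<close>

definition cell_count_poly :: "nat \<Rightarrow> nat \<Rightarrow> real \<Rightarrow> real \<Rightarrow> real poly" where
  "cell_count_poly d m r \<rho> = ([:(2 * \<rho> + r) / r, 1 / r:] ^ d + 1) ^ (d + m)"

lemma cell_count_poly_pos:
  assumes "0 < r" "0 \<le> \<rho>" "0 \<le> \<tau>"
  shows "0 < poly (cell_count_poly d m r \<rho>) \<tau>"
  using assms by (simp add: cell_count_poly_def poly_power add_nonneg_pos)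

lemma delone_num_cells_with_vertex_in_cball_le:
  fixes A :: "'a::euclidean_space set"
  assumes del: "delone r R A" "0 < r" and J: "finite J" "f ` A \<subseteq> J"
    and colors: "J \<subseteq> f ` (A \<inter> cball x \<tau>)" and nonneg: "0 \<le> \<tau>" "0 \<le> \<rho>"
  shows "num_cells_with_vertex_in (cball x \<rho>) (color_overlay A J f)
    \<le> ennreal (poly (cell_count_poly DIM('a) (card J) r \<rho>) \<tau>)"
proof -
  let ?n = "card (A \<inter> cball x (\<tau> + 2 * \<rho>))"
  have locfin: "locally_finite A" using del by (rule delone_imp_locally_finite)
  have "real ?n \<le> ((\<tau> + 2 * \<rho> + r) / r) ^ DIM('a)"
    using locfin nonneg
    by (intro delone_card_subset_cball_le[OF del]) (auto simp: locally_finite_def)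
  then have "real ((?n + 1) ^ (DIM('a) + card J))
      \<le> (((\<tau> + 2 * \<rho> + r) / r) ^ DIM('a) + 1) ^ (DIM('a) + card J)"
    unfolding of_nat_power by (intro power_mono) auto
  also have "\<dots> = poly (cell_count_poly DIM('a) (card J) r \<rho>) \<tau>"
    by (simp add: cell_count_poly_def poly_power add_divide_distrib add_ac)
  finally have card: "real ((?n + 1) ^ (DIM('a) + card J))
      \<le> poly (cell_count_poly DIM('a) (card J) r \<rho>) \<tau>" .
  have "num_cells_with_vertex_in (cball x \<rho>) (color_overlay A J f)
      \<le> of_nat ((?n + 1) ^ (DIM('a) + card J))"
    using locfin J colors by (rule num_cells_with_vertex_in_cball_le)
  also have "\<dots> \<le> ennreal (poly (cell_count_poly DIM('a) (card J) r \<rho>) \<tau>)"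
    unfolding ennreal_of_nat_eq_real_of_nat using card by (rule ennreal_leI)
  finally show ?thesis .
qed

lemma delone_emeasure_missing_color_le:
  fixes A :: "'a::euclidean_space set" and t :: nat
  assumes "delone r R A" "0 < r" "0 < R" and J: "finite J" "J \<noteq> {}"
  shows "emeasure (random_coloring A J)
      {f \<in> space (random_coloring A J). \<not> J \<subseteq> f ` (A \<inter> cball x (3 * R * real t))}
    \<le> ennreal (card J * exp (- (t / card J)))" (is "?prob \<le> _")
proof -
  have "?prob \<le> ennreal (card J * exp (- (card (A \<inter> cball x (3 * R * real t)) / card J)))"
    using delone_imp_locally_finite[OF assms(1,2)] J
    by (intro emeasure_random_coloring_missing_color_le) (auto simp: locally_finite_def)
  also have "\<dots> \<le> ennreal (card J * exp (- (t / card J)))"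
    using delone_card_cball_ge[OF assms(1-3)]
    by (intro ennreal_leI mult_left_mono) (auto intro: divide_right_mono)
  finally show ?thesis .
qed

lemma delone_expected_num_cells_le_suminf:
  fixes A :: "'a::euclidean_space set"
  assumes del: "delone r R A" "0 < r" "0 < R" and rho_nonneg: "0 \<le> \<rho>" and J: "finite J" "J \<noteq> {}"
  defines "p \<equiv> cell_count_poly DIM('a) (card J) r \<rho>"
  shows "(\<integral>\<^sup>+f. num_cells_with_vertex_in (cball x \<rho>) (color_overlay A J f) \<partial>random_coloring A J)
    \<le> ennreal (poly p 0) +
      (\<Sum>t. ennreal (poly p (3 * R * real (Suc t)) * (card J * exp (- (t / card J)))))"
proof -
  let ?P = "random_coloring A J" and ?Q = "\<lambda>t. A \<inter> cball x (3 * R * real t)"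
  let ?N = "\<lambda>f. num_cells_with_vertex_in (cball x \<rho>) (color_overlay A J f)"
  interpret prob_space ?P using J by (rule prob_space_random_coloring)
  have "(\<integral>\<^sup>+f. ?N f \<partial>?P) \<le> ennreal (poly p (3 * R * real 0)) * emeasure ?P (space ?P) +
      (\<Sum>t. ennreal (poly p (3 * R * real (Suc t))) * emeasure ?P {f \<in> space ?P. \<not> J \<subseteq> f ` ?Q t})"
  proof (rule nn_integral_le_suminf_first_time)
    show "{f \<in> space ?P. J \<subseteq> f ` ?Q t} \<in> sets ?P" for t
      using delone_imp_locally_finite[OF del(1,2)] J
      by (intro sets_random_coloring_all_colors) (auto simp: locally_finite_def)
    show "?N f \<le> ennreal (poly p (3 * R * real t))" if "f \<in> space ?P" "J \<subseteq> f ` ?Q t" for t f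
      unfolding p_def using that del(3) rho_nonneg
      by (intro delone_num_cells_with_vertex_in_cball_le[OF del(1,2) J(1)])
        (auto simp: space_random_coloring)
    show "\<exists>t. J \<subseteq> f ` ?Q t" if "?N f \<noteq> 0" for f
      using that del(3) by (intro ex_nat_colors_if_num_cells_with_vertex_in_nonzero[OF J(1)]) auto
  qed
  also have "\<dots> \<le> ennreal (poly p 0) +
      (\<Sum>t. ennreal (poly p (3 * R * real (Suc t)) * (card J * exp (- (t / card J)))))"
    using del(3) delone_emeasure_missing_color_le[OF del J]
      cell_count_poly_pos[OF del(2) rho_nonneg]
    by (intro add_mono suminf_le)
      (auto simp: p_def emeasure_space_1 ennreal_mult less_imp_le intro!: mult_left_mono)
  finally show ?thesis .
qed

lemma expected_num_cells_with_vertex_in_cball_le: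
  fixes J :: "'j set"
  assumes r_pos: "0 < r" and R_pos: "0 < R" and rho_nonneg: "0 \<le> \<rho>" and J: "finite J" "J \<noteq> {}"
  shows "\<exists>C>0. \<forall>(A :: 'a::euclidean_space set) x. delone r R A \<longrightarrow>
    (\<integral>\<^sup>+f. num_cells_with_vertex_in (cball x \<rho>) (color_overlay A J f) \<partial>random_coloring A J)
      \<le> ennreal C"
proof -
  define p where "p = cell_count_poly DIM('a) (card J) r \<rho>"
  define b where "b t = poly p (3 * R * real (Suc t)) * (card J * exp (- (t / card J)))"
    for t :: nat
  have p_pos: "0 < poly p \<tau>" if "0 \<le> \<tau>" for \<tau>
    unfolding p_def using r_pos rho_nonneg that by (rule cell_count_poly_pos)
  then have b_nonneg: "0 \<le> b t" for t
    using R_pos by (simp add: b_def less_imp_le)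
  have "0 < card J" using J by (simp add: card_gt_0_iff)
  then have "summable (\<lambda>t. card J *
      (poly (p \<circ>\<^sub>p [:3 * R, 3 * R:]) (real t) * exp (- (1 / card J) * t)))"
    by (intro summable_mult summable_poly_times_exp) simp
  then have summable_b: "summable b"
    unfolding b_def by (simp add: poly_pcompose algebra_simps)
  have ennreal_sum: "ennreal (poly p 0) + (\<Sum>t. ennreal (b t)) = ennreal (poly p 0 + (\<Sum>t. b t))"
    using suminf_ennreal2[OF b_nonneg summable_b] p_pos[of 0] suminf_nonneg[OF summable_b b_nonneg]
    by (simp add: ennreal_plus less_imp_le)
  show ?thesis
  proof (intro exI[of _ "poly p 0 + (\<Sum>t. b t)"] conjI allI impI)
    show "0 < poly p 0 + (\<Sum>t. b t)"
      using p_pos[of 0] suminf_nonneg[OF summable_b b_nonneg] by simp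
    fix A :: "'a set" and x assume "delone r R A"
    then show "(\<integral>\<^sup>+f. num_cells_with_vertex_in (cball x \<rho>) (color_overlay A J f)
        \<partial>random_coloring A J) \<le> ennreal (poly p 0 + (\<Sum>t. b t))"
      unfolding ennreal_sum[symmetric] unfolding b_def p_def
      by (rule delone_expected_num_cells_le_suminf[OF _ r_pos R_pos rho_nonneg J])
  qed
qed

lemma expected_num_cells_with_vertex_in_cball_le_card:
  fixes A :: "'a::euclidean_space set"
  assumes del: "delone r R A" and r_pos: "0 < r" and R: "0 < R" "R \<le> \<omega>" and J: "finite J"
    and le: "\<And>a. (\<integral>\<^sup>+f. num_cells_with_vertex_in (cball a (2 * R)) (color_overlay A J f)
      \<partial>random_coloring A J) \<le> C"
  shows "(\<integral>\<^sup>+f. num_cells_with_vertex_in (cball x \<omega>) (color_overlay A J f) \<partial>random_coloring A J)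
    \<le> C * of_nat (card (A \<inter> cball x \<omega>))"
proof -
  let ?P = "random_coloring A J" and ?Q = "A \<inter> cball x \<omega>"
  let ?N = "\<lambda>\<Omega> f. num_cells_with_vertex_in \<Omega> (color_overlay A J f)"
  have locfin: "locally_finite A" using del r_pos by (rule delone_imp_locally_finite)
  have "?N (cball x \<omega>) f \<le> (\<Sum>a\<in>?Q. ?N (cball a (2 * R)) f)" for f
    using locfin delone_cball_subset_UN[OF del R]
    by (intro num_cells_with_vertex_in_UN_le) (auto simp: locally_finite_def)
  then have "(\<integral>\<^sup>+f. ?N (cball x \<omega>) f \<partial>?P) \<le> (\<integral>\<^sup>+f. (\<Sum>a\<in>?Q. ?N (cball a (2 * R)) f) \<partial>?P)"
    by (intro nn_integral_mono)
  also have "\<dots> = (\<Sum>a\<in>?Q. \<integral>\<^sup>+f. ?N (cball a (2 * R)) f \<partial>?P)"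
    using locfin J R by (intro nn_integral_sum borel_measurable_num_cells_with_vertex_in_cball) auto
  also have "\<dots> \<le> (\<Sum>a\<in>?Q. C)" using le by (intro sum_mono)
  finally show ?thesis by (simp add: mult.commute)
qed

theorem mainTheorem8:
  fixes s :: nat and r R :: real
  assumes "0 < r" and "r < R"
  shows "\<exists>C>0. \<forall>(A :: (real ^ 'd) set) (\<omega> :: real).
    delone r R A \<and> R < \<omega> \<longrightarrow>
      (let \<sigma> = {0..s};
           \<Omega> = cball 0 \<omega>;
           n = card (A \<inter> \<Omega>);
           P = random_coloring A \<sigma>;
           N = (\<lambda>f. num_cells_with_vertex_in \<Omega> (Ovl \<sigma> (\<lambda>j. Vor (color_class A f j))))
       in N \<in> borel_measurable P \<and> (\<integral>\<^sup>+ f. N f \<partial>P) \<le> ennreal (C * real n))"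
proof -
  have R_pos: "0 < R" using assms by simp
  obtain C where "0 < C" and local_bound: "\<And>(A :: (real ^ 'd) set) x. delone r R A \<Longrightarrow>
      (\<integral>\<^sup>+f. num_cells_with_vertex_in (cball x (2 * R)) (color_overlay A {0..s} f)
        \<partial>random_coloring A {0..s}) \<le> ennreal C"
    using expected_num_cells_with_vertex_in_cball_le[OF assms(1) R_pos, of "2 * R" "{0..s}"] R_pos
    by auto
  show ?thesis
    unfolding Let_def
  proof (intro exI[of _ C] conjI allI impI \<open>0 < C\<close>; elim conjE)
    fix A :: "(real ^ 'd) set" and \<omega> :: real
    assume del: "delone r R A" and "R < \<omega>"
    show "(\<lambda>f. num_cells_with_vertex_in (cball 0 \<omega>) (color_overlay A {0..s} f))
        \<in> borel_measurable (random_coloring A {0..s})"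
      using delone_imp_locally_finite[OF del assms(1)] \<open>R < \<omega>\<close> R_pos
      by (intro borel_measurable_num_cells_with_vertex_in_cball) auto
    show "(\<integral>\<^sup>+f. num_cells_with_vertex_in (cball 0 \<omega>) (color_overlay A {0..s} f)
        \<partial>random_coloring A {0..s}) \<le> ennreal (C * real (card (A \<inter> cball 0 \<omega>)))"
      using expected_num_cells_with_vertex_in_cball_le_card
          [OF del assms(1) R_pos _ _ local_bound[OF del]] \<open>R < \<omega>\<close> \<open>0 < C\<close>
      by (simp add: ennreal_mult ennreal_of_nat_eq_real_of_nat)
  qed
qed

end
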